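(* Let $p$ be an odd prime, $m$ a positive even integer, $s=m/2$, $q=p^m$, $u$ a positive integer and $v=\gcd(m,u)$. Let $\mathrm{Tr}$ denote the trace map from $\mathbb{F}_q$ to $\mathbb{F}_p$. Let \[ D_1=\{(x,y)\in\mathbb{F}_q^2\setminus\{(0,0)\} : \mathrm{Tr}(x+y^{p^u+1})=0\}, \] and $C_{D_1}=\{c(a,b)=(\mathrm{Tr}(ax+by))_{(x,y)\in D_1} : a,b\in\mathbb{F}_q\}$. If $\frac{m}{v}\equiv 0\pmod 4$, then $C_{D_1}$ is a $[p^{2m-1}-1,2m]$ three-weight linear code over $\mathbb{F}_p$ whose weight distribution is: weight $0$ with multiplicity $1$; weight $(p-1)p^{2m-2}$ with multiplicity $p^{2m}-1-(p-1)p^{m-2v}$; weight $(p-1)p^{2m-2}\left(1+\frac{1}{p^{s-v}}\right)$ with multiplicity $(p-1)(p^{m-2v-1}-p^{s-v}+p^{s-v-1})$; and weight $(p-1)p^{2m-2}\left(1-\frac{1}{(p-1)p^{s-v}}\right)$ with multiplicity $(p-1)(p^{s-v}+1)(p^{s-v}-p^{s-v-1})$.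
   Context: An $[n,k]$ linear code over $\mathbb{F}_p$ is a $k$-dimensional subspace of $\mathbb{F}_p^n$. The multiplicity of a weight $w$ is the number of codewords of Hamming weight $w$; a code is $t$-weight if exactly $t$ nonzero weights occur. *)

theory Defs
  imports Complex_Main "HOL-Library.Cardinality" "HOL-Computational_Algebra.Primes"
begin

text \<open>Finite field F_q is modelled as a finite field type 'a with CARD('a) = q = p^m.
  The absolute trace Tr : F_q -> F_p, Tr(x) = sum_{i<m} x^(p^i); its values lie in the
  prime subfield, which we view inside 'a.\<close>

definition tr :: "nat \<Rightarrow> nat \<Rightarrow> 'a::field \<Rightarrow> 'a" where
  "tr p m x = (\<Sum>i<m. x ^ (p ^ i))"

definition D1 :: "nat \<Rightarrow> nat \<Rightarrow> nat \<Rightarrow> ('a::{field,finite} \<times> 'a) set" where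
  "D1 p m u = {(x, y). (x, y) \<noteq> (0, 0) \<and> tr p m (x + y ^ (p ^ u + 1)) = 0}"

text \<open>The codeword c(a,b), as a vector indexed by D_1 (extended by 0 outside D_1).\<close>
definition cw :: "nat \<Rightarrow> nat \<Rightarrow> nat \<Rightarrow> 'a::{field,finite} \<Rightarrow> 'a \<Rightarrow> ('a \<times> 'a \<Rightarrow> 'a)" where
  "cw p m u a b = (\<lambda>(x, y). if (x, y) \<in> D1 p m u then tr p m (a * x + b * y) else 0)"

definition code :: "nat \<Rightarrow> nat \<Rightarrow> nat \<Rightarrow> ('a::{field,finite} \<times> 'a \<Rightarrow> 'a) set" where
  "code p m u = {cw p m u a b | a b. True}"

definition hwt :: "nat \<Rightarrow> nat \<Rightarrow> nat \<Rightarrow> ('a::{field,finite} \<times> 'a \<Rightarrow> 'a) \<Rightarrow> nat" where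
  "hwt p m u c = card {z \<in> D1 p m u. c z \<noteq> 0}"

definition wmult :: "nat \<Rightarrow> nat \<Rightarrow> nat \<Rightarrow> ('a::{field,finite}) itself \<Rightarrow> nat \<Rightarrow> nat" where
  "wmult p m u T w =
     card {c \<in> (code p m u :: ('a \<times> 'a \<Rightarrow> 'a) set). hwt p m u c = w}"

end

theory Submission
  imports
    Defs
    "HOL-Computational_Algebra.Polynomial"
    "HOL-Library.Product_Plus"
    "HOL-Number_Theory.Cong"
begin

text \<open>
  Put \<open>Q y = Tr (y ^ (p ^ u + 1))\<close> and let \<open>(a, b) \<noteq> (0, 0)\<close>. Unless \<open>a\<close> is a nonzero element of the
  prime field, \<open>Tr x + Q y = 0\<close> and \<open>Tr (a x + b y) = 0\<close> are independent. If it is, the weight of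
  \<open>c(a, b)\<close> is determined by the number of solutions of \<open>Q y = Tr (b / a y)\<close>. The quadratic form
  \<open>Q\<close> has a radical of \<open>p ^ (2 v)\<close> elements; if \<open>Tr (b / a y)\<close> does not vanish on it, all values of
  \<open>Q y - Tr (b / a y)\<close> are equally frequent, and otherwise completing the square reduces to counting
  a level set of \<open>Q\<close>.

  The sizes of the level sets are found without character sums. The nonzero ones are equinumerous
  because every nonzero element of the prime field is a \<open>(p ^ u + 1)\<close>-th power; counting the pairs
  with \<open>Q y = Q z\<close> then determines their size up to a sign, and the sign follows from divisibility
  by \<open>p ^ v + 1\<close>, as the \<open>(p ^ v + 1)\<close>-th roots of unity act freely on each of them.
\<close>

subsection \<open>Counting by fibres\<close>

lemma card_eq_sum_card_fibres:
  assumes "finite A" "finite B" "f ` A \<subseteq> B"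
  shows "card A = (\<Sum>b\<in>B. card {a \<in> A. f a = b})"
  using sum.group[OF assms, of "\<lambda>_. 1::nat"] by simp

lemma card_fibre_eq_of_bounds:
  assumes fibration: "finite A" "finite B" "f ` A \<subseteq> B" and "b \<in> B"
    and fibre_le: "\<And>b. b \<in> B \<Longrightarrow> card {a \<in> A. f a = b} \<le> d"
    and "card B \<le> e" "card A = d * e"
  shows "card {a \<in> A. f a = b} = d"
proof (rule ccontr)
  assume "card {a \<in> A. f a = b} \<noteq> d"
  with fibre_le[OF \<open>b \<in> B\<close>] have less: "card {a \<in> A. f a = b} < d" by simp
  have "card A < (\<Sum>b\<in>B. d)"
    unfolding card_eq_sum_card_fibres[OF fibration]
    by (rule sum_strict_mono_ex1) (use fibration \<open>b \<in> B\<close> fibre_le less in auto)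
  also have "\<dots> \<le> d * e" using \<open>card B \<le> e\<close> by simp
  finally show False using \<open>card A = d * e\<close> by simp
qed

lemma sum_if_mult_eq:
  fixes c d :: nat
  assumes "finite A" "B \<subseteq> A" "d > 0"
  shows "(\<Sum>x\<in>A. if x \<in> B then d * c else c) = (card A + (d - 1) * card B) * c"
proof -
  have "(\<Sum>x\<in>A. if x \<in> B then d * c else c) = (\<Sum>x\<in>A. c + (if x \<in> B then (d - 1) * c else 0))"
    using \<open>d > 0\<close> by (intro sum.cong) (auto simp: algebra_simps simp flip: mult_Suc)
  also have "\<dots> = card A * c + card B * ((d - 1) * c)"
    using assms by (simp add: sum.distrib Int_absorb1 flip: sum.inter_restrict)
  finally show ?thesis by (simp add: algebra_simps)
qed

lemma card_level_set_translation:
  fixes f :: "'b::ab_group_add \<Rightarrow> 'c::ab_group_add"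
  assumes "finite V" "finite K" "f ` V \<subseteq> K" "t \<in> K"
    and K_diff: "\<And>a b. a \<in> K \<Longrightarrow> b \<in> K \<Longrightarrow> a - b \<in> K"
    and shift: "\<And>l z. l \<in> K \<Longrightarrow> z \<in> V \<Longrightarrow> z + h l \<in> V \<and> f (z + h l) = f z + l"
  shows "card K * card {z \<in> V. f z = t} = card V"
proof -
  have card_le: "card {z \<in> V. f z = a} \<le> card {z \<in> V. f z = b}" if "a \<in> K" "b \<in> K" for a b
  proof (rule card_inj_on_le)
    show "inj_on (\<lambda>z. z + h (b - a)) {z \<in> V. f z = a}" by (auto intro: inj_onI)
    show "(\<lambda>z. z + h (b - a)) ` {z \<in> V. f z = a} \<subseteq> {z \<in> V. f z = b}"
    proof clarify
      fix z assume "z \<in> V" "a = f z"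
      thus "z + h (b - f z) \<in> V \<and> f (z + h (b - f z)) = b"
        using shift[OF K_diff[OF that(2,1)], of z] by simp
    qed
  qed (use \<open>finite V\<close> in auto)
  have "card V = (\<Sum>b\<in>K. card {z \<in> V. f z = b})"
    using assms(1-3) by (rule card_eq_sum_card_fibres)
  also have "\<dots> = (\<Sum>b\<in>K. card {z \<in> V. f z = t})"
    by (intro sum.cong refl antisym card_le) (use \<open>t \<in> K\<close> in auto)
  finally show ?thesis by simp
qed

lemma (in additive) card_eq_card_kernel_mult_card_image:
  assumes "finite S" "\<And>c r. c \<in> S \<Longrightarrow> f r = 0 \<Longrightarrow> c + r \<in> S"
  shows "card S = card {r. f r = 0} * card (f ` S)"
proof -
  have "card {c \<in> S. f c = b} = card {r. f r = 0}" if b_in_image: "b \<in> f ` S" for b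
  proof -
    obtain c where "c \<in> S" "b = f c" using b_in_image by blast
    hence "bij_betw (\<lambda>r. c + r) {r. f r = 0} {c \<in> S. f c = b}"
      by (intro bij_betw_byWitness[where f' = "\<lambda>x. x - c"]) (auto simp: assms add diff)
    thus ?thesis by (rule bij_betw_same_card[symmetric])
  qed
  moreover have "card S = (\<Sum>b\<in>f ` S. card {c \<in> S. f c = b})"
    using \<open>finite S\<close> by (intro card_eq_sum_card_fibres) auto
  ultimately show ?thesis by simp
qed

subsection \<open>Powers in finite fields\<close>

lemma power_minus_1_dvd_power_minus_1:
  fixes a :: nat
  assumes "a > 0" "d dvd n"
  shows "a ^ d - 1 dvd a ^ n - 1"
proof -
  have "[a ^ d = 1] (mod (a ^ d - 1))" using \<open>a > 0\<close> by (simp add: cong_altdef_nat)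
  from cong_pow[OF this, of "n div d"] have "[(a ^ d) ^ (n div d) = 1] (mod (a ^ d - 1))" by simp
  thus ?thesis using assms by (simp add: cong_altdef_nat flip: power_mult)
qed

lemma power_card_minus_1_eq_1:
  fixes x :: "'a::{field,finite}"
  assumes "x \<noteq> 0"
  shows "x ^ (CARD('a) - 1) = 1"
proof -
  have "(\<Prod>y\<in>UNIV-{0}. x * y) = (\<Prod>y\<in>UNIV-{0}. y)"
    by (rule prod.reindex_bij_witness[of _ "\<lambda>y. y / x" "\<lambda>y. x * y"]) (use assms in auto)
  moreover have "(\<Prod>y\<in>UNIV-{0}. x * y) = x ^ (CARD('a) - 1) * (\<Prod>y\<in>UNIV-{0}. y)"
    by (simp add: prod.distrib card_Diff_singleton)
  ultimately show ?thesis by simp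
qed

lemma card_power_eq_le:
  fixes b :: "'a::idom"
  assumes "d > 0"
  shows "card {x. x ^ d = b} \<le> d"
proof -
  let ?P = "monom 1 d - [:b:]"
  have "coeff ?P d = 1" using assms by (simp add: coeff_pCons split: nat.splits)
  hence P_nonzero: "?P \<noteq> 0" by (metis coeff_0 zero_neq_one)
  have "degree ?P \<le> d" by (intro degree_diff_le) (auto simp: degree_monom_le)
  moreover have "{x. x ^ d = b} = {x. poly ?P x = 0}" by (auto simp: poly_monom)
  ultimately show ?thesis using card_poly_roots_bound[OF P_nonzero] by simp
qed

lemma card_power_eq:
  fixes b :: "'a::{field,finite}"
  assumes "d * e dvd CARD('a) - 1" "b ^ e = 1"
  shows "card {x. x ^ d = b} = d"
proof -
  obtain k where "CARD('a) - 1 = d * e * k" using assms(1) by (rule dvdE)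
  hence card_eq: "CARD('a) - 1 = d * (e * k)" by (simp only: mult.assoc)
  have b_power: "b ^ (e * k) = 1" using assms(2) by (simp add: power_mult)
  have "CARD('a) > 1" using card_mono[of UNIV "{0, 1::'a}"] by simp
  hence pos: "d > 0" "e * k > 0" using card_eq by (auto intro!: Nat.gr0I)
  have "card {x \<in> UNIV - {0}. x ^ d = b} = d"
  proof (rule card_fibre_eq_of_bounds)
    show "(\<lambda>x. x ^ d) ` (UNIV - {0::'a}) \<subseteq> {z. z ^ (e * k) = 1}"
      using power_card_minus_1_eq_1[where 'a = 'a] unfolding card_eq by (auto simp flip: power_mult)
    show "card {z::'a. z ^ (e * k) = 1} \<le> e * k" by (rule card_power_eq_le) fact
    show "card (UNIV - {0::'a}) = d * (e * k)" using card_eq by (simp add: card_Diff_singleton)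
    show "card {x \<in> UNIV - {0}. x ^ d = c} \<le> d" for c :: 'a
      by (rule order.trans[OF card_mono card_power_eq_le[OF pos(1), of c]]) auto
  qed (use b_power in auto)
  moreover have "{x \<in> UNIV - {0}. x ^ d = b} = {x. x ^ d = b}"
    using b_power pos by (auto simp: power_0_left split: if_splits)
  ultimately show ?thesis by simp
qed

corollary ex_power_eq:
  fixes b :: "'a::{field,finite}"
  assumes "d * e dvd CARD('a) - 1" "b ^ e = 1" "d > 0"
  shows "\<exists>x. x ^ d = b"
proof -
  have "{x. x ^ d = b} \<noteq> {}" using card_power_eq[OF assms(1,2)] \<open>d > 0\<close> by (intro notI) simp
  thus ?thesis by blast
qed

lemma card_roots_of_unity_dvd_card:
  fixes S :: "'a::field set"
  assumes "finite S" "0 \<notin> S"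
    and closed: "\<And>x z. x ^ d = 1 \<Longrightarrow> z \<in> S \<Longrightarrow> x * z \<in> S"
  shows "card {x::'a. x ^ d = 1} dvd card S"
proof -
  have "card {y \<in> S. y ^ d = b} = card {x::'a. x ^ d = 1}"
      if b_in_image: "b \<in> (\<lambda>z. z ^ d) ` S" for b
  proof -
    obtain z where z_in_fibre: "z \<in> S" "b = z ^ d" using b_in_image by blast
    hence "z \<noteq> 0" using \<open>0 \<notin> S\<close> by auto
    hence "bij_betw (\<lambda>x. x * z) {x. x ^ d = 1} {y \<in> S. y ^ d = b}"
      by (intro bij_betw_byWitness[where f' = "\<lambda>y. y / z"])
        (auto simp: z_in_fibre closed power_mult_distrib power_divide)
    thus ?thesis by (rule bij_betw_same_card[symmetric])
  qed
  moreover have "card S = (\<Sum>b\<in>(\<lambda>z. z ^ d) ` S. card {y \<in> S. y ^ d = b})"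
    using \<open>finite S\<close> by (intro card_eq_sum_card_fibres) auto
  ultimately show ?thesis by simp
qed

subsection \<open>The trace of a finite field\<close>

locale finite_field_trace =
  fixes p m :: nat and ty :: "'a::{field,finite} itself"
  assumes prime_p: "prime p" and m_pos: "m > 0"
    and card_UNIV: "CARD('a) = p ^ m" and char_p: "CHAR('a) = p"
begin

abbreviation Tr :: "'a \<Rightarrow> 'a" where "Tr \<equiv> tr p m"

definition prime_subfield :: "'a set" where "prime_subfield = {x. x ^ p = x}"

lemma p_gt_1: "p > 1"
  using prime_p by (rule prime_gt_1_nat)

lemma additive_frobenius: "additive (\<lambda>x::'a. x ^ (p ^ i))"
  by unfold_locales (rule freshmans_dream'[of _ i]; simp add: prime_p char_p)

lemmas frobenius_add = additive.add[OF additive_frobenius]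
lemmas frobenius_minus = additive.minus[OF additive_frobenius]
lemmas frobenius_diff = additive.diff[OF additive_frobenius]

lemma power_card_power_eq_same: "(x::'a) ^ (p ^ (m * k)) = x"
proof (induction k)
  case (Suc k)
  have "x ^ (p ^ m) = x"
  proof (cases "x = 0")
    case False
    have "x ^ (p ^ m) = x ^ (p ^ m - 1) * x"
      using p_gt_1 by (simp flip: power_Suc2)
    thus ?thesis using power_card_minus_1_eq_1[OF False] by (simp add: card_UNIV)
  qed (use p_gt_1 in \<open>simp add: power_0_left\<close>)
  thus ?case using Suc by (simp add: power_add power_mult)
qed simp

lemma frobenius_fixed_mult: "(x::'a) ^ (p ^ a) = x \<Longrightarrow> x ^ (p ^ (a * n)) = x"
  by (induction n) (simp_all add: power_add power_mult)

lemma frobenius_negated_mult: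
  assumes "(x::'a) ^ (p ^ a) = - x"
  shows "x ^ (p ^ (a * n)) = (- 1) ^ n * x"
proof (induction n)
  case (Suc n)
  have "x ^ (p ^ (a * Suc n)) = (x ^ (p ^ (a * n))) ^ (p ^ a)"
    by (simp add: add.commute flip: power_mult power_add)
  also have "\<dots> = (- 1) ^ Suc n * x"
    using Suc assms frobenius_minus[of x a] by (cases "even n") auto
  finally show ?case .
qed simp

lemma frobenius_fixed_gcd:
  assumes "(x::'a) ^ (p ^ a) = x" "a > 0"
  shows "x ^ (p ^ gcd a m) = x"
proof -
  obtain i j where bezout: "a * i = m * j + gcd a m"
    using bezout_nat[of a m] \<open>a > 0\<close> by auto
  have "x = x ^ (p ^ (a * i))" using frobenius_fixed_mult[OF assms(1)] by simp
  also have "\<dots> = (x ^ (p ^ (m * j))) ^ (p ^ gcd a m)"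
    by (simp add: bezout power_add power_mult)
  finally show ?thesis by (simp add: power_card_power_eq_same)
qed

lemma card_frobenius_fixed:
  assumes "d dvd m" "d > 0"
  shows "card {x::'a. x ^ (p ^ d) = x} = p ^ d"
proof -
  have gt_1: "p ^ d > 1" using p_gt_1 \<open>d > 0\<close> by (rule one_less_power)
  have "p ^ d - 1 dvd CARD('a) - 1"
    using power_minus_1_dvd_power_minus_1[OF _ \<open>d dvd m\<close>, of p] p_gt_1 by (simp add: card_UNIV)
  hence "card {x::'a. x ^ (p ^ d - 1) = 1} = p ^ d - 1"
    by (intro card_power_eq[where e = 1]) simp_all
  moreover have "{x::'a. x ^ (p ^ d) = x} = insert 0 {x. x ^ (p ^ d - 1) = 1}"
  proof -
    have "x ^ (p ^ d) = x * x ^ (p ^ d - 1)" for x :: 'a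
      using p_gt_1 by (simp flip: power_Suc)
    thus ?thesis by auto
  qed
  moreover have "0 \<notin> {x::'a. x ^ (p ^ d - 1) = 1}"
    using gt_1 by (simp add: power_0_left)
  ultimately show ?thesis using gt_1 by simp
qed

lemma card_prime_subfield: "card prime_subfield = p"
  using card_frobenius_fixed[of 1] by (simp add: prime_subfield_def)

lemma prime_subfield_power: "l \<in> prime_subfield \<Longrightarrow> l ^ (p ^ i) = l"
  by (induction i) (auto simp: prime_subfield_def power_mult)

lemma prime_subfield_0: "0 \<in> prime_subfield"
  and prime_subfield_1: "1 \<in> prime_subfield"
  using p_gt_1 by (auto simp: prime_subfield_def)

lemma prime_subfield_add: "a \<in> prime_subfield \<Longrightarrow> b \<in> prime_subfield \<Longrightarrow> a + b \<in> prime_subfield"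
  using frobenius_add[of a b 1] by (auto simp: prime_subfield_def)

lemma prime_subfield_minus: "a \<in> prime_subfield \<Longrightarrow> - a \<in> prime_subfield"
  using frobenius_minus[of a 1] by (auto simp: prime_subfield_def)

lemma prime_subfield_diff: "a \<in> prime_subfield \<Longrightarrow> b \<in> prime_subfield \<Longrightarrow> a - b \<in> prime_subfield"
  using frobenius_diff[of a b 1] by (auto simp: prime_subfield_def)

lemma prime_subfield_divide: "a \<in> prime_subfield \<Longrightarrow> b \<in> prime_subfield \<Longrightarrow> a / b \<in> prime_subfield"
  by (auto simp: prime_subfield_def power_divide)

sublocale tr: additive Tr
  by unfold_locales (simp add: tr_def frobenius_add sum.distrib)

lemma tr_scale: "l \<in> prime_subfield \<Longrightarrow> Tr (l * x) = l * Tr x"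
  by (simp add: tr_def power_mult_distrib prime_subfield_power sum_distrib_left)

lemma tr_power_p: "Tr (x ^ p) = Tr x"
proof -
  have "Tr (x ^ p) + x = (\<Sum>i<m. x ^ p ^ Suc i) + x"
    by (simp add: tr_def flip: power_mult)
  also have "\<dots> = (\<Sum>i<Suc m. x ^ p ^ i)"
    by (subst sum.lessThan_Suc_shift) simp
  also have "\<dots> = Tr x + x"
    using power_card_power_eq_same[of x 1] by (simp add: tr_def)
  finally show ?thesis by simp
qed

lemma tr_frobenius: "Tr (x ^ (p ^ i)) = Tr x"
  by (induction i) (auto simp: power_mult tr_power_p mult.commute[of p])

lemma tr_in_prime_subfield: "Tr x \<in> prime_subfield"
proof -
  have "Tr x ^ p = Tr (x ^ p)"
    unfolding tr_def
    by (subst freshmans_dream_sum) (simp_all add: prime_p char_p mult.commute flip: power_mult)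
  thus ?thesis by (simp add: prime_subfield_def tr_power_p)
qed

lemma ex_tr_neq_0: "\<exists>x. Tr x \<noteq> 0"
proof -
  let ?P = "\<Sum>i<m. monom (1::'a) (p ^ i)"
  have "coeff ?P (p ^ (m - 1)) = (\<Sum>i<m. if i = m - 1 then 1 else 0)"
    using p_gt_1 by (auto simp: coeff_sum intro!: sum.cong)
  hence "coeff ?P (p ^ (m - 1)) = 1" using m_pos by simp
  hence P_nonzero: "?P \<noteq> 0" by (metis coeff_0 zero_neq_one)
  have "degree ?P \<le> p ^ (m - 1)"
  proof (rule degree_sum_le)
    fix i assume "i \<in> {..<m}"
    hence "p ^ i \<le> p ^ (m - 1)" using p_gt_1 by (intro power_increasing) auto
    thus "degree (monom (1::'a) (p ^ i)) \<le> p ^ (m - 1)"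
      using degree_monom_le order.trans by blast
  qed simp
  moreover have "{x. Tr x = 0} = {x. poly ?P x = 0}"
    by (simp add: poly_monom poly_sum tr_def)
  ultimately have "card {x. Tr x = 0} \<le> p ^ (m - 1)"
    using card_poly_roots_bound[OF P_nonzero] by simp
  also have "\<dots> < CARD('a)"
    using p_gt_1 m_pos by (simp add: card_UNIV power_strict_increasing)
  finally have "{x. Tr x = 0} \<noteq> UNIV" by auto
  thus ?thesis by auto
qed

definition prime_subspace :: "'a set \<Rightarrow> bool" where
  "prime_subspace V \<longleftrightarrow>
    0 \<in> V \<and> (\<forall>x\<in>V. \<forall>y\<in>V. x + y \<in> V) \<and> (\<forall>l\<in>prime_subfield. \<forall>x\<in>V. l * x \<in> V)"

definition tr_orthogonal :: "'a set \<Rightarrow> 'a set" where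
  "tr_orthogonal V = {b. \<forall>r\<in>V. Tr (b * r) = 0}"

lemma prime_subspace_UNIV: "prime_subspace UNIV"
  by (simp add: prime_subspace_def)

lemma tr_orthogonal_UNIV: "tr_orthogonal UNIV = {0}"
proof -
  obtain y where "Tr y \<noteq> 0" using ex_tr_neq_0 by blast
  have "\<exists>x. Tr (c * x) \<noteq> 0" if "c \<noteq> 0" for c
    using that \<open>Tr y \<noteq> 0\<close> by (intro exI[of _ "y / c"]) simp
  thus ?thesis by (auto simp: tr_orthogonal_def tr.zero)
qed

lemma ex_tr_mult_eq_1:
  assumes "prime_subspace V" "b \<notin> tr_orthogonal V"
  shows "\<exists>r\<in>V. Tr (b * r) = 1"
proof -
  obtain r where "r \<in> V" "Tr (b * r) \<noteq> 0" using assms(2) by (auto simp: tr_orthogonal_def)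
  have inverse: "1 / Tr (b * r) \<in> prime_subfield"
    by (intro prime_subfield_divide prime_subfield_1 tr_in_prime_subfield)
  hence "1 / Tr (b * r) * r \<in> V"
    using assms(1) \<open>r \<in> V\<close> unfolding prime_subspace_def by blast
  moreover have "Tr (b * (1 / Tr (b * r) * r)) = 1"
    using \<open>Tr (b * r) \<noteq> 0\<close> tr_scale[OF inverse, of "b * r"] by (simp add: mult.left_commute)
  ultimately show ?thesis by blast
qed

lemma tr_nondegenerate: "c \<noteq> 0 \<Longrightarrow> \<exists>x. Tr (c * x) = 1"
  using ex_tr_mult_eq_1[OF prime_subspace_UNIV, of c] by (simp add: tr_orthogonal_UNIV)

lemma tr_mult_eq_imp_eq:
  assumes "\<And>z. Tr (c * z) = Tr (d * z)"
  shows "c = d"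
proof (rule ccontr)
  assume "c \<noteq> d"
  then obtain z where "Tr ((c - d) * z) = 1" using tr_nondegenerate[of "c - d"] by auto
  thus False using assms[of z] by (simp add: left_diff_distrib tr.diff)
qed

lemma tr_separates:
  assumes "a \<notin> prime_subfield"
  shows "\<exists>x. Tr x = 0 \<and> Tr (a * x) = 1"
proof -
  obtain x1 where "Tr x1 = 1" using tr_nondegenerate[of 1] by auto
  define l where "l = Tr (a * x1)"
  have "l \<in> prime_subfield" by (simp add: l_def tr_in_prime_subfield)
  hence "a - l \<noteq> 0" using assms by auto
  then obtain x where x_normalized: "Tr ((a - l) * x) = 1" using tr_nondegenerate by blast
  have "Tr (x - Tr x * x1) = 0"
    using tr_scale[OF tr_in_prime_subfield] \<open>Tr x1 = 1\<close> by (simp add: tr.diff)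
  moreover have "Tr (a * (x - Tr x * x1)) = 1"
    using x_normalized tr_scale[OF tr_in_prime_subfield, of x "a * x1"]
      tr_scale[OF \<open>l \<in> prime_subfield\<close>, of x]
    by (simp add: algebra_simps tr.diff l_def)
  ultimately show ?thesis by blast
qed

lemma card_level_set:
  fixes f :: "'b::{ab_group_add,finite} \<Rightarrow> 'a"
  assumes "\<And>z. z \<in> V \<Longrightarrow> f z \<in> prime_subfield" "t \<in> prime_subfield"
    and "\<And>l z. l \<in> prime_subfield \<Longrightarrow> z \<in> V \<Longrightarrow> z + h l \<in> V \<and> f (z + h l) = f z + l"
  shows "p * card {z \<in> V. f z = t} = card V"
  using card_level_set_translation[of V prime_subfield f t h] assms
  by (simp add: card_prime_subfield prime_subfield_diff image_subset_iff)

lemma card_tr_mult_level_set: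
  assumes subspace_V: "prime_subspace V" and "b \<notin> tr_orthogonal V" "t \<in> prime_subfield"
  shows "p * card {z \<in> V. Tr (b * z) = t} = card V"
proof -
  obtain r where r_normalized: "r \<in> V" "Tr (b * r) = 1" using ex_tr_mult_eq_1[OF assms(1,2)] by blast
  show ?thesis
  proof (rule card_level_set[where h = "\<lambda>l. l * r"])
    fix l z assume "l \<in> prime_subfield" "z \<in> V"
    thus "z + l * r \<in> V \<and> Tr (b * (z + l * r)) = Tr (b * z) + l"
      using subspace_V r_normalized
      by (simp add: prime_subspace_def distrib_left tr.add tr_scale mult.left_commute[of b])
  qed (use \<open>t \<in> prime_subfield\<close> tr_in_prime_subfield in auto)
qed

lemma card_tr_hyperplane:
  assumes "c \<noteq> 0" "t \<in> prime_subfield"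
  shows "p * card {z. Tr (c * z) = t} = p ^ m"
  using card_tr_mult_level_set[OF prime_subspace_UNIV _ assms(2), of c] assms(1)
  by (simp add: tr_orthogonal_UNIV card_UNIV)

lemma card_tr_mult_eq_0:
  assumes "prime_subspace V"
  shows "p * card {z \<in> V. Tr (b * z) = 0} = (if b \<in> tr_orthogonal V then p * card V else card V)"
proof (cases "b \<in> tr_orthogonal V")
  case True
  hence "{z \<in> V. Tr (b * z) = 0} = V" by (auto simp: tr_orthogonal_def)
  thus ?thesis using True by simp
qed (use card_tr_mult_level_set[OF assms _ prime_subfield_0] in simp)

lemma card_mult_card_tr_orthogonal:
  assumes "prime_subspace V"
  shows "card V * card (tr_orthogonal V) = p ^ m"
proof -
  have "0 \<in> V" using assms by (simp add: prime_subspace_def)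
  have "(p ^ m + (p - 1) * card (tr_orthogonal V)) * card V
      = (\<Sum>b\<in>UNIV. p * card {r \<in> V. Tr (b * r) = 0})"
    using p_gt_1 by (simp add: card_tr_mult_eq_0[OF assms] sum_if_mult_eq card_UNIV)
  also have "\<dots> = p * (\<Sum>r\<in>V. card {b \<in> UNIV. Tr (b * r) = 0})"
    unfolding sum_distrib_left[symmetric] by (subst sum_multicount_gen[of UNIV V]) auto
  also have "\<dots> = (\<Sum>r\<in>V. p * card {b \<in> UNIV. Tr (r * b) = 0})"
    by (simp add: sum_distrib_left mult.commute)
  also have "\<dots> = (card V + (p - 1) * card {0::'a}) * p ^ m"
    unfolding card_tr_mult_eq_0[OF prime_subspace_UNIV] tr_orthogonal_UNIV card_UNIV
    using p_gt_1 \<open>0 \<in> V\<close> by (intro sum_if_mult_eq) auto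
  finally have "(p - 1) * (card V * card (tr_orthogonal V)) = (p - 1) * p ^ m"
    by (simp add: algebra_simps)
  thus ?thesis using p_gt_1 by simp
qed

subsection \<open>Sections of trace graphs\<close>

definition trace_graph :: "('a \<Rightarrow> 'a) \<Rightarrow> ('a \<times> 'a) set" where
  "trace_graph f = {(x, y). Tr x + f y = 0}"

definition trace_graph_section :: "('a \<Rightarrow> 'a) \<Rightarrow> 'a \<Rightarrow> 'a \<Rightarrow> ('a \<times> 'a) set" where
  "trace_graph_section f a b = {(x, y) \<in> trace_graph f. Tr (a * x + b * y) = 0}"

context
  fixes f :: "'a \<Rightarrow> 'a"
  assumes f_in_prime_subfield: "\<And>y. f y \<in> prime_subfield"
begin

lemma card_trace_graph_over: "p * card {(x, y) \<in> trace_graph f. y \<in> S} = p ^ m * card S"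
proof -
  obtain x0 where "Tr x0 = 1" using tr_nondegenerate[of 1] by auto
  hence "p * card {z \<in> UNIV \<times> S. Tr (fst z) + f (snd z) = 0} = card ((UNIV :: 'a set) \<times> S)"
    by (intro card_level_set[where h = "\<lambda>l. (l * x0, 0)"])
      (auto simp: tr.add tr_scale tr_in_prime_subfield f_in_prime_subfield prime_subfield_0
        prime_subfield_add)
  moreover have "{z \<in> UNIV \<times> S. Tr (fst z) + f (snd z) = 0} = {(x, y) \<in> trace_graph f. y \<in> S}"
    by (auto simp: trace_graph_def)
  ultimately show ?thesis by (simp add: card_cartesian_product card_UNIV)
qed

lemma card_trace_graph: "p * card (trace_graph f) = p ^ (2 * m)"
  using card_trace_graph_over[of UNIV] by (simp add: card_UNIV mult_2 power_add)

lemma card_trace_graph_section_not_prime_subfield: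
  assumes "a \<notin> prime_subfield"
  shows "p * card (trace_graph_section f a b) = card (trace_graph f)"
proof -
  obtain x0 where x0_separates: "Tr x0 = 0" "Tr (a * x0) = 1" using tr_separates[OF assms] by blast
  have "p * card {z \<in> trace_graph f. Tr (a * fst z + b * snd z) = 0} = card (trace_graph f)"
  proof (rule card_level_set[where h = "\<lambda>l. (l * x0, 0)"])
    fix l z assume "l \<in> prime_subfield" "z \<in> trace_graph f"
    thus "z + (l * x0, 0) \<in> trace_graph f \<and>
      Tr (a * fst (z + (l * x0, 0)) + b * snd (z + (l * x0, 0))) = Tr (a * fst z + b * snd z) + l"
      using x0_separates
      by (auto simp: trace_graph_def tr.add tr_scale distrib_left mult.left_commute[of a])
  qed (auto simp: tr_in_prime_subfield prime_subfield_0)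
  moreover have "{z \<in> trace_graph f. Tr (a * fst z + b * snd z) = 0} = trace_graph_section f a b"
    by (auto simp: trace_graph_section_def)
  ultimately show ?thesis by simp
qed

lemma card_trace_graph_section_0:
  assumes "b \<noteq> 0"
  shows "p * card (trace_graph_section f 0 b) = card (trace_graph f)"
proof -
  have "trace_graph_section f 0 b = {(x, y) \<in> trace_graph f. y \<in> {y. Tr (b * y) = 0}}"
    by (auto simp: trace_graph_section_def)
  hence "p * (p * card (trace_graph_section f 0 b)) = p ^ m * (p * card {y. Tr (b * y) = 0})"
    by (simp only: card_trace_graph_over mult.left_commute)
  also have "\<dots> = p * card (trace_graph f)"
    using card_tr_hyperplane[OF assms prime_subfield_0] by (simp add: card_trace_graph mult_2 power_add)
  finally show ?thesis using p_gt_1 by simp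
qed

lemma card_trace_graph_section_prime_subfield:
  assumes "a \<in> prime_subfield" "a \<noteq> 0"
  shows "p * card (trace_graph_section f a b) = p ^ m * card {y. f y = Tr (b / a * y)}"
proof -
  have "Tr x + f y = 0 \<and> Tr (a * x + b * y) = 0 \<longleftrightarrow> Tr x + f y = 0 \<and> f y = Tr (b / a * y)" for x y
  proof -
    have "Tr (a * x + b * y) = Tr (a * (x + b / a * y))" using assms by (simp add: algebra_simps)
    also have "\<dots> = a * (Tr x + Tr (b / a * y))" using assms by (simp only: tr_scale tr.add)
    finally show ?thesis using assms by (auto simp: add_eq_0_iff)
  qed
  hence "trace_graph_section f a b = {(x, y) \<in> trace_graph f. y \<in> {y. f y = Tr (b / a * y)}}"
    by (auto simp: trace_graph_section_def trace_graph_def)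
  thus ?thesis by (simp only: card_trace_graph_over)
qed

end

end

subsection \<open>Quadratic forms over the prime field\<close>

locale trace_quadratic_form = finite_field_trace p m ty
  for p m and ty :: "'a::{field,finite} itself" +
  fixes Q L :: "'a \<Rightarrow> 'a"
  assumes odd_p: "odd p"
    and Q_in_prime_subfield: "Q y \<in> prime_subfield"
    and Q_scale: "l \<in> prime_subfield \<Longrightarrow> Q (l * y) = l ^ 2 * Q y"
    and Q_add: "Q (y + z) = Q y + Q z + Tr (L y * z)"
begin

lemma tr_L_commute: "Tr (L y * z) = Tr (L z * y)"
  using Q_add[of y z] Q_add[of z y] by (simp add: add.commute)

sublocale L: additive L
proof
  fix c d
  have "Tr (L (c + d) * z) = Tr ((L c + L d) * z)" for z
    by (simp add: tr_L_commute[of _ z] distrib_right distrib_left tr.add)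
  thus "L (c + d) = L c + L d" by (rule tr_mult_eq_imp_eq)
qed

lemma L_scale:
  assumes "l \<in> prime_subfield"
  shows "L (l * c) = l * L c"
proof (rule tr_mult_eq_imp_eq)
  fix z
  show "Tr (L (l * c) * z) = Tr (l * L c * z)"
    using assms
    by (simp add: tr_L_commute[of "l * c"] tr_L_commute[of c] mult.left_commute[of _ l] mult.assoc
        tr_scale)
qed

lemma two_neq_0: "(2::'a) \<noteq> 0"
proof
  assume "(2::'a) = 0"
  hence "of_nat 2 = (0::'a)" by simp
  hence "p dvd 2" unfolding of_nat_eq_0_iff_char_dvd char_p .
  hence "p \<le> 2" by (rule dvd_imp_le) simp
  hence "p = 2" using p_gt_1 by simp
  thus False using odd_p by simp
qed

lemma tr_L_self: "Tr (L y * y) = 2 * Q y"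
proof -
  have "2 \<in> prime_subfield"
    using prime_subfield_add[OF prime_subfield_1 prime_subfield_1] by simp
  hence "Q (y + y) = 2 ^ 2 * Q y" using Q_scale[of 2 y] by (simp only: mult_2)
  thus ?thesis using Q_add[of y y] by simp
qed

definition radical :: "'a set" where "radical = {c. L c = 0}"

lemma prime_subspace_radical: "prime_subspace radical"
  by (simp add: prime_subspace_def radical_def L.zero L.add L_scale)

lemma zero_in_radical: "0 \<in> radical"
  using prime_subspace_radical by (simp add: prime_subspace_def)

lemma Q_radical: "r \<in> radical \<Longrightarrow> Q r = 0"
  using tr_L_self[of r] two_neq_0 by (simp add: radical_def tr.zero)

lemma Q_add_radical: "r \<in> radical \<Longrightarrow> Q (y + r) = Q y"
  using Q_radical by (simp add: Q_add tr_L_commute[of y] radical_def tr.zero)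

lemma Q_eq_if_L_eq: "L c = L d \<Longrightarrow> Q c = Q d"
  using Q_add_radical[of "c - d" d] by (simp add: radical_def L.diff)

lemma card_eq_card_radical_mult_card_L_image:
  assumes "\<And>c r. c \<in> S \<Longrightarrow> r \<in> radical \<Longrightarrow> c + r \<in> S"
  shows "card S = card radical * card (L ` S)"
  using L.card_eq_card_kernel_mult_card_image[of S] assms by (simp add: radical_def)

lemma range_L: "range L = tr_orthogonal radical"
proof (rule card_subset_eq)
  show "range L \<subseteq> tr_orthogonal radical"
    unfolding tr_orthogonal_def
  proof clarify
    fix c r assume "r \<in> radical"
    thus "Tr (L c * r) = 0" using tr_L_commute[of c r] by (simp add: radical_def tr.zero)
  qed
  have "radical \<noteq> {}" using zero_in_radical by auto
  moreover have "card radical * card (range L) = card radical * card (tr_orthogonal radical)"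
    using card_eq_card_radical_mult_card_L_image[of UNIV]
    by (simp add: card_mult_card_tr_orthogonal prime_subspace_radical card_UNIV)
  ultimately show "card (range L) = card (tr_orthogonal radical)" by simp
qed simp

definition level_card :: "'a \<Rightarrow> nat" where "level_card t = card {y. Q y = t}"

lemma card_Q_eq_tr_L: "card {y. Q y = Tr (L c * y)} = level_card (Q c)"
proof -
  have completing_square: "Q (y + c) = Tr (L c * (y + c)) \<longleftrightarrow> Q y = Q c" for y
    by (auto simp: Q_add distrib_left tr.add tr_L_self tr_L_commute[of y])
  have "bij_betw (\<lambda>y. y + c) {y. Q y = Q c} {y. Q y = Tr (L c * y)}"
  proof (rule bij_betw_byWitness[where f' = "\<lambda>y. y - c"])
    show "(\<lambda>y. y - c) ` {y. Q y = Tr (L c * y)} \<subseteq> {y. Q y = Q c}"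
      using completing_square[of "_ - c"] by auto
  qed (use completing_square in auto)
  thus ?thesis by (simp add: level_card_def bij_betw_same_card)
qed

lemma card_Q_eq_tr_not_range_L:
  assumes "b \<notin> range L"
  shows "p * card {y. Q y = Tr (b * y)} = p ^ m"
proof -
  obtain r where r_normalized: "r \<in> radical" "Tr (b * r) = 1"
    using ex_tr_mult_eq_1[OF prime_subspace_radical] assms by (auto simp: range_L)
  have "p * card {y \<in> UNIV. Tr (b * y) - Q y = 0} = card (UNIV :: 'a set)"
  proof (rule card_level_set[where h = "\<lambda>l. l * r"])
    fix l z assume "l \<in> prime_subfield"
    moreover from this have "l * r \<in> radical"
      using r_normalized prime_subspace_radical by (simp add: prime_subspace_def)
    ultimately show "z + l * r \<in> UNIV \<and> Tr (b * (z + l * r)) - Q (z + l * r) = Tr (b * z) - Q z + l"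
      using r_normalized
      by (simp add: Q_add_radical distrib_left tr.add tr_scale mult.left_commute[of b])
  qed (auto simp: prime_subfield_0 prime_subfield_diff tr_in_prime_subfield Q_in_prime_subfield)
  moreover have "{y \<in> UNIV. Tr (b * y) - Q y = 0} = {y. Q y = Tr (b * y)}" by auto
  ultimately show ?thesis by (simp add: card_UNIV)
qed

lemma card_pairs_Q_eq:
  "p * card {(y, z). Q y = Q z} = (p ^ m + (p - 1) * card radical) * p ^ m"
proof -
  have "Tr (L (y - z) * z) = - Q (y - z) \<longleftrightarrow> Q y = Q z" for y z
    using Q_add[of "y - z" z] by (simp add: eq_neg_iff_add_eq_0 add.commute)
  hence "bij_betw (\<lambda>(y, z). (y - z, z)) {(y, z). Q y = Q z} (SIGMA x:UNIV. {z. Tr (L x * z) = - Q x})"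
    by (intro bij_betw_byWitness[where f' = "\<lambda>(x, z). (x + z, z)"]) (auto simp: Q_add)
  hence "card {(y, z). Q y = Q z} = (\<Sum>x\<in>UNIV. card {z. Tr (L x * z) = - Q x})"
    by (simp add: bij_betw_same_card)
  hence "p * card {(y, z). Q y = Q z} = (\<Sum>x\<in>UNIV. p * card {z. Tr (L x * z) = - Q x})"
    by (simp add: sum_distrib_left)
  also have "\<dots> = (\<Sum>x\<in>UNIV. if x \<in> radical then p * p ^ m else p ^ m)"
  proof (rule sum.cong)
    fix x
    show "p * card {z. Tr (L x * z) = - Q x} = (if x \<in> radical then p * p ^ m else p ^ m)"
      using Q_radical[of x] card_tr_hyperplane[of "L x" "- Q x"]
      by (auto simp: radical_def tr.zero card_UNIV prime_subfield_minus Q_in_prime_subfield)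
  qed simp
  also have "\<dots> = (p ^ m + (p - 1) * card radical) * p ^ m"
    using p_gt_1 by (simp add: sum_if_mult_eq card_UNIV)
  finally show ?thesis .
qed

lemma sum_level_card: "(\<Sum>t\<in>prime_subfield. level_card t) = p ^ m"
  unfolding level_card_def
  using card_eq_sum_card_fibres[of UNIV prime_subfield Q] Q_in_prime_subfield
  by (simp add: card_UNIV image_subset_iff)

lemma sum_level_card_square: "(\<Sum>t\<in>prime_subfield. level_card t ^ 2) = card {(y, z). Q y = Q z}"
proof -
  have "card {(y, z). Q y = Q z} = (\<Sum>t\<in>prime_subfield. card {yz \<in> {(y, z). Q y = Q z}. Q (fst yz) = t})"
    by (rule card_eq_sum_card_fibres) (auto simp: Q_in_prime_subfield)
  also have "\<dots> = (\<Sum>t\<in>prime_subfield. level_card t ^ 2)"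
  proof (rule sum.cong)
    fix t
    have "{yz \<in> {(y, z). Q y = Q z}. Q (fst yz) = t} = {y. Q y = t} \<times> {y. Q y = t}" by auto
    thus "card {yz \<in> {(y, z). Q y = Q z}. Q (fst yz) = t} = level_card t ^ 2"
      by (simp add: level_card_def power2_eq_square card_cartesian_product)
  qed simp
  finally show ?thesis by simp
qed

definition level_discrepancy :: int where
  "level_discrepancy = int (p ^ m) - int p * int (level_card 1)"

context
  assumes level_card_nonzero: "\<forall>t\<in>prime_subfield - {0}. level_card t = level_card 1"
begin

lemma sum_prime_subfield_level_card:
  fixes g :: "nat \<Rightarrow> nat"
  shows "(\<Sum>t\<in>prime_subfield. g (level_card t)) = g (level_card 0) + (p - 1) * g (level_card 1)"
proof -
  have "(\<Sum>t\<in>prime_subfield-{0}. g (level_card t)) = (\<Sum>t\<in>prime_subfield-{0}. g (level_card 1))"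
    using level_card_nonzero by (intro sum.cong) auto
  thus ?thesis
    using prime_subfield_0 by (simp add: sum.remove[of _ 0] card_prime_subfield card_Diff_singleton)
qed

lemma level_card_0: "int p * int (level_card 0) = int (p ^ m) + (int p - 1) * level_discrepancy"
proof -
  have "int (p ^ m) = int (level_card 0) + (int p - 1) * int (level_card 1)"
    using sum_prime_subfield_level_card[of "\<lambda>n. n"] p_gt_1 by (simp add: sum_level_card)
  thus ?thesis unfolding level_discrepancy_def by algebra
qed

lemma level_discrepancy_square: "level_discrepancy ^ 2 = int (card radical) * int (p ^ m)"
proof -
  define P q r where "P = int p" and "q = int (p ^ m)" and "r = int (card radical)"
  have P_gt_1: "int (p - 1) = P - 1" "P > 1" using p_gt_1 by (simp_all add: P_def)
  have "P * (int (level_card 0) ^ 2 + (P - 1) * int (level_card 1) ^ 2) = (q + (P - 1) * r) * q"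
    using arg_cong[OF card_pairs_Q_eq, of int] P_gt_1(1) unfolding P_def q_def r_def
    by (simp add: sum_prime_subfield_level_card[of "\<lambda>n. n ^ 2"] flip: sum_level_card_square)
  moreover have "P * int (level_card 0) = q + (P - 1) * level_discrepancy"
    using level_card_0 by (simp add: P_def q_def)
  moreover have "P * int (level_card 1) = q - level_discrepancy"
    by (simp add: level_discrepancy_def P_def q_def)
  ultimately have "P * (P - 1) * level_discrepancy ^ 2 = P * (P - 1) * (r * q)" by algebra
  thus ?thesis using P_gt_1(2) by (simp add: q_def r_def)
qed

end

end

subsection \<open>The quadratic form \<open>Tr (y ^ (p ^ u + 1))\<close>\<close>

locale gold_form = finite_field_trace p m ty
  for p m and ty :: "'a::{field,finite} itself" +
  fixes u :: nat
  assumes p_odd: "odd p"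
begin

definition gold :: "'a \<Rightarrow> 'a" where "gold y = Tr (y ^ (p ^ u + 1))"

text \<open>The exponent \<open>(m - 1) * u\<close> inverts the \<open>u\<close>-th power of Frobenius.\<close>

definition gold_polar :: "'a \<Rightarrow> 'a" where "gold_polar c = c ^ (p ^ u) + c ^ (p ^ ((m - 1) * u))"

lemma u_add_m_minus_1_mult_u: "u + (m - 1) * u = m * u"
  using m_pos by (cases m) auto

lemma tr_mult_frobenius: "Tr (y * z ^ (p ^ u)) = Tr (y ^ (p ^ ((m - 1) * u)) * z)"
proof -
  have "Tr (y * z ^ (p ^ u)) = Tr ((y * z ^ (p ^ u)) ^ (p ^ ((m - 1) * u)))"
    by (simp only: tr_frobenius)
  also have "\<dots> = Tr (y ^ (p ^ ((m - 1) * u)) * z ^ (p ^ (m * u)))"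
    by (simp add: power_mult_distrib u_add_m_minus_1_mult_u del: One_nat_def flip: power_mult power_add)
  finally show ?thesis by (simp add: power_card_power_eq_same)
qed

sublocale trace_quadratic_form p m ty gold gold_polar
proof
  show "odd p" by (rule p_odd)
  show "gold y \<in> prime_subfield" for y by (simp add: gold_def tr_in_prime_subfield)
  show "gold (l * y) = l ^ 2 * gold y" if "l \<in> prime_subfield" for l y
  proof -
    have "(l * y) ^ (p ^ u + 1) = l * (l * y ^ (p ^ u + 1))"
      using that by (simp add: power_mult_distrib prime_subfield_power mult_ac)
    thus ?thesis using that by (simp only: gold_def tr_scale power2_eq_square mult.assoc)
  qed
  show "gold (y + z) = gold y + gold z + Tr (gold_polar y * z)" for y z
    by (simp add: gold_def gold_polar_def power_add frobenius_add distrib_left distrib_right tr.add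
        tr_mult_frobenius mult.commute add_ac)
qed

lemma gold_radical_iff: "c \<in> radical \<longleftrightarrow> c ^ (p ^ (2 * u)) = - c"
proof -
  have "gold_polar c ^ (p ^ u) = c ^ (p ^ (2 * u)) + c ^ (p ^ (m * u))"
    using u_add_m_minus_1_mult_u
    by (simp add: gold_polar_def frobenius_add mult_2 add.commute flip: power_mult power_add)
  hence "gold_polar c ^ (p ^ u) = c ^ (p ^ (2 * u)) + c"
    by (simp only: power_card_power_eq_same)
  moreover have "gold_polar c ^ (p ^ u) = 0 \<longleftrightarrow> gold_polar c = 0" using p_gt_1 by simp
  ultimately show ?thesis by (simp add: radical_def add_eq_0_iff2)
qed

end

locale gold_code = gold_form p m ty u
  for p m and ty :: "'a::{field,finite} itself" and u +
  fixes v s :: nat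
  assumes u_pos: "u > 0" and v_eq: "v = gcd m u" and s_eq: "s = m div 2"
    and four_dvd_m_div_v: "4 dvd m div v"
begin

lemma v_pos: "v > 0"
  using u_pos by (simp add: v_eq)

lemma four_mult_v_dvd_m: "4 * v dvd m"
proof -
  have "4 * v dvd m div v * v" using four_dvd_m_div_v by (rule mult_dvd_mono) simp
  thus ?thesis by (simp add: v_eq)
qed

lemma m_eq: "m = 2 * s"
  using four_mult_v_dvd_m by (auto simp: s_eq)

lemma two_mult_v_dvd_s: "2 * v dvd s"
  using four_mult_v_dvd_m by (auto simp: s_eq)

lemma v_less_s: "v < s"
  using two_mult_v_dvd_s m_pos v_pos by (auto simp: m_eq dest: dvd_imp_le)

lemma odd_u_div_v: "odd (u div v)"
proof
  assume "even (u div v)"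
  hence "2 * v dvd u div v * v" by (rule mult_dvd_mono) simp
  hence "2 * v dvd u" by (simp add: v_eq)
  moreover have "2 * v dvd m" using two_mult_v_dvd_s by (auto simp: m_eq)
  ultimately have "2 * v dvd v" by (simp add: v_eq)
  thus False using v_pos by (auto dest: dvd_imp_le)
qed

lemma u_eq: "u = v * (u div v)"
  by (simp add: v_eq)

lemma gcd_double_u_m: "gcd (2 * u) m = 2 * v"
proof -
  have "v dvd u" "v dvd s" using two_mult_v_dvd_s by (auto simp: v_eq dest: dvd_mult_right)
  moreover have "gcd u s dvd v" by (auto simp: v_eq m_eq)
  ultimately have "gcd u s = v" by (intro dvd_antisym gcd_greatest)
  thus ?thesis by (simp add: m_eq flip: gcd_mult_distrib_nat)
qed

lemma power_2v_dvd_card_minus_1: "(p ^ (2 * v) - 1) * (p ^ (2 * v) + 1) dvd CARD('a) - 1"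
proof -
  have "(p ^ (2 * v) - 1) * (p ^ (2 * v) + 1) = p ^ (4 * v) - 1"
    by (simp add: algebra_simps flip: power_add)
  also have "\<dots> dvd p ^ m - 1"
    using p_gt_1 four_mult_v_dvd_m by (intro power_minus_1_dvd_power_minus_1) auto
  finally show ?thesis by (simp only: card_UNIV)
qed

lemma power_v_dvd_card_minus_1: "(p ^ v + 1) * (p - 1) dvd CARD('a) - 1"
proof -
  have "p - 1 dvd p ^ v - 1"
    using power_minus_1_dvd_power_minus_1[of p 1 v] p_gt_1 by simp
  hence "(p ^ v + 1) * (p - 1) dvd (p ^ v + 1) * (p ^ v - 1)" by (rule mult_dvd_mono[OF dvd_refl])
  also have "\<dots> = p ^ (2 * v) - 1" by (simp add: algebra_simps flip: power_add mult_2_right)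
  also have "\<dots> dvd CARD('a) - 1" using power_2v_dvd_card_minus_1 by (rule dvd_mult_left)
  finally show ?thesis .
qed

lemma ex_frobenius_negated: "\<exists>y::'a. y \<noteq> 0 \<and> y ^ (p ^ (2 * v)) = - y"
proof -
  have gt_1: "p ^ (2 * v) > 1" using p_gt_1 v_pos by (intro one_less_power) auto
  obtain y :: 'a where "y ^ (p ^ (2 * v) - 1) = - 1"
    using ex_power_eq[OF power_2v_dvd_card_minus_1, of "- 1"] gt_1 p_odd by auto
  moreover have "y ^ (p ^ (2 * v)) = y ^ (p ^ (2 * v) - 1) * y"
    using gt_1 by (simp only: power_minus_mult)
  ultimately show ?thesis using gt_1 by (intro exI[of _ y]) (auto simp: power_0_left)
qed

lemma card_radical: "card radical = p ^ (2 * v)"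
proof -
  obtain y :: 'a where "y \<noteq> 0" "y ^ (p ^ (2 * v)) = - y" using ex_frobenius_negated by blast
  hence y_negated: "y \<noteq> 0" "y ^ (p ^ (2 * u)) = - y"
    using frobenius_negated_mult[of y "2 * v" "u div v"] odd_u_div_v
    by (simp_all add: mult.assoc flip: u_eq)
  have "bij_betw (\<lambda>x. x * y) {x. x ^ (p ^ (2 * v)) = x} radical"
  proof (rule bij_betw_byWitness[where f' = "\<lambda>r. r / y"])
    show "(\<lambda>x. x * y) ` {x. x ^ (p ^ (2 * v)) = x} \<subseteq> radical"
    proof clarify
      fix x :: 'a assume "x ^ (p ^ (2 * v)) = x"
      hence "x ^ (p ^ (2 * u)) = x"
        using frobenius_fixed_mult[of x "2 * v" "u div v"] by (simp add: mult.assoc flip: u_eq)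
      thus "x * y \<in> radical" using y_negated by (simp add: gold_radical_iff power_mult_distrib)
    qed
    show "(\<lambda>r. r / y) ` radical \<subseteq> {x. x ^ (p ^ (2 * v)) = x}"
    proof clarify
      fix r assume "r \<in> radical"
      hence "(r / y) ^ (p ^ (2 * u)) = r / y" using y_negated by (simp add: gold_radical_iff power_divide)
      thus "(r / y) ^ (p ^ (2 * v)) = r / y"
        using frobenius_fixed_gcd[of "r / y" "2 * u"] u_pos by (simp add: gcd_double_u_m)
    qed
  qed (use y_negated in auto)
  moreover have "2 * v dvd m" using two_mult_v_dvd_s by (auto simp: m_eq)
  ultimately show ?thesis using card_frobenius_fixed[of "2 * v"] v_pos
    by (simp add: bij_betw_same_card[symmetric])
qed

lemma power_gold_exponent_eq:
  assumes "x ^ (p ^ v + 1) = (t::'a)" "t \<in> prime_subfield" "t \<noteq> 0"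
  shows "x ^ (p ^ u + 1) = t"
proof -
  have "x \<noteq> 0" using assms by auto
  hence power_v: "x ^ (p ^ v) = t / x" using assms by (simp add: field_simps)
  have "x ^ (p ^ (2 * v)) = (x ^ (p ^ v)) ^ (p ^ v)"
    by (simp add: mult_2 flip: power_mult power_add)
  also have "\<dots> = x" using \<open>x \<noteq> 0\<close> assms by (simp add: power_v power_divide prime_subfield_power)
  finally have fixed: "x ^ (p ^ (2 * v)) = x" .
  obtain j where "u div v = 2 * j + 1" using odd_u_div_v oddE by blast
  hence "u = 2 * v * j + v" using u_eq by (simp add: algebra_simps)
  hence "x ^ (p ^ u) = (x ^ (p ^ (2 * v * j))) ^ (p ^ v)"
    by (simp flip: power_mult power_add)
  also have "\<dots> = x ^ (p ^ v)" by (simp only: frobenius_fixed_mult[OF fixed])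
  finally show ?thesis using assms by simp
qed

lemma level_card_gold_nonzero: "\<forall>t\<in>prime_subfield - {0}. level_card t = level_card 1"
proof
  fix t :: 'a assume "t \<in> prime_subfield - {0}"
  hence t_unit: "t \<in> prime_subfield" "t \<noteq> 0" by auto
  have "t * t ^ (p - 1) = t * 1" using t_unit p_gt_1 by (simp add: prime_subfield_def flip: power_Suc)
  hence "t ^ (p - 1) = 1" using t_unit by simp
  then obtain x where "x ^ (p ^ v + 1) = t"
    using ex_power_eq[OF power_v_dvd_card_minus_1, of t] by auto
  hence x_power: "x ^ (p ^ u + 1) = t" using power_gold_exponent_eq t_unit by blast
  hence "x \<noteq> 0" using t_unit by auto
  have gold_mult: "gold (x * y) = t * gold y" for y
    by (simp only: gold_def power_mult_distrib x_power tr_scale[OF t_unit(1)])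
  have "bij_betw (\<lambda>y. x * y) {y. gold y = 1} {y. gold y = t}"
  proof (rule bij_betw_byWitness[where f' = "\<lambda>y. y / x"])
    show "(\<lambda>y. y / x) ` {y. gold y = t} \<subseteq> {y. gold y = 1}"
    proof clarify
      fix y assume "t = gold y"
      thus "gold (y / x) = 1" using gold_mult[of "y / x"] \<open>x \<noteq> 0\<close> \<open>t \<noteq> 0\<close> by simp
    qed
  qed (use gold_mult \<open>x \<noteq> 0\<close> in auto)
  thus "level_card t = level_card 1" by (simp add: level_card_def bij_betw_same_card)
qed

lemma dvd_level_card:
  assumes "t \<noteq> 0"
  shows "p ^ v + 1 dvd level_card t"
proof -
  have "card {x::'a. x ^ (p ^ v + 1) = 1} = p ^ v + 1"
    by (rule card_power_eq[OF power_v_dvd_card_minus_1]) simp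
  moreover have "card {x::'a. x ^ (p ^ v + 1) = 1} dvd card {y. gold y = t}"
  proof (rule card_roots_of_unity_dvd_card)
    show "0 \<notin> {y. gold y = t}" using assms Q_radical[OF zero_in_radical] by simp
    fix x z :: 'a assume "x ^ (p ^ v + 1) = 1" "z \<in> {y. gold y = t}"
    moreover from this have "x ^ (p ^ u + 1) = 1"
      by (intro power_gold_exponent_eq prime_subfield_1) simp_all
    ultimately show "x * z \<in> {y. gold y = t}"
      by (simp only: gold_def power_mult_distrib mult_1_left mem_Collect_eq)
  qed simp
  ultimately show ?thesis by (simp add: level_card_def)
qed

lemma level_discrepancy_cong_1: "[level_discrepancy = 1] (mod int (p ^ v + 1))"
proof -
  have "p ^ v + 1 dvd p ^ m - 1"
    using dvd_mult_left[OF power_v_dvd_card_minus_1] by (simp only: card_UNIV)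
  hence "int (p ^ v + 1) dvd int (p ^ m) - 1"
    using p_gt_1 by (simp only: of_nat_diff of_nat_1 one_le_power less_imp_le flip: int_dvd_int_iff)
  moreover have "int (p ^ v + 1) dvd int p * int (level_card 1)"
    using dvd_level_card[OF one_neq_zero] by (intro dvd_mult) (simp only: int_dvd_int_iff)
  ultimately have "int (p ^ v + 1) dvd int (p ^ m) - 1 - int p * int (level_card 1)" by (rule dvd_diff)
  thus ?thesis by (simp add: cong_iff_dvd_diff level_discrepancy_def algebra_simps)
qed

lemma power_s_plus_v_cong: "[int (p ^ (s + v)) = - 1] (mod int (p ^ v + 1))"
proof -
  obtain j where "s = 2 * v * j" using two_mult_v_dvd_s by (auto simp: dvd_def)
  hence "s + v = v * (2 * j + 1)" by (simp add: algebra_simps)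
  hence "int (p ^ (s + v)) = int (p ^ v) ^ (2 * j + 1)" by (simp only: power_mult of_nat_power)
  moreover have "[int (p ^ v) ^ (2 * j + 1) = (- 1) ^ (2 * j + 1)] (mod int (p ^ v + 1))"
    by (intro cong_pow) (simp add: cong_iff_dvd_diff add.commute)
  moreover have "(- 1 :: int) ^ (2 * j + 1) = - 1" by simp
  ultimately show ?thesis by (simp only:)
qed

lemma level_discrepancy_eq: "level_discrepancy = - int (p ^ (s + v))"
proof -
  have "level_discrepancy ^ 2 = int (p ^ (2 * v)) * int (p ^ m)"
    using level_discrepancy_square[OF level_card_gold_nonzero] by (simp add: card_radical)
  also have "\<dots> = int (p ^ (s + v)) ^ 2"
    by (simp add: m_eq algebra_simps flip: power_mult power_add)
  finally have "level_discrepancy = int (p ^ (s + v)) \<or> level_discrepancy = - int (p ^ (s + v))"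
    by (simp only: power2_eq_iff)
  moreover have "level_discrepancy \<noteq> int (p ^ (s + v))"
  proof
    assume "level_discrepancy = int (p ^ (s + v))"
    hence "[1 = - 1] (mod int (p ^ v + 1))"
      using level_discrepancy_cong_1 power_s_plus_v_cong by (metis cong_sym cong_trans)
    hence "int (p ^ v + 1) dvd 2" by (simp add: cong_iff_dvd_diff)
    hence "int (p ^ v + 1) \<le> 2" by (rule zdvd_imp_le) simp
    moreover have "int p ^ v > 1" using p_gt_1 v_pos by (intro one_less_power) auto
    ultimately show False by simp
  qed
  ultimately show ?thesis by blast
qed

lemma real_level_card_0: "real (level_card 0) = (real p ^ m - (real p - 1) * real p ^ (s + v)) / real p"
proof -
  have "int p * int (level_card 0) = int (p ^ m) + (int p - 1) * - int (p ^ (s + v))"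
    using level_card_0[OF level_card_gold_nonzero] by (simp only: level_discrepancy_eq)
  from arg_cong[OF this, of real_of_int] show ?thesis using p_gt_1 by (simp add: field_simps)
qed

lemma real_level_card_1: "real (level_card 1) = (real p ^ m + real p ^ (s + v)) / real p"
proof -
  have "int p * int (level_card 1) = int (p ^ m) + int (p ^ (s + v))"
    using level_discrepancy_eq unfolding level_discrepancy_def by linarith
  from arg_cong[OF this, of real_of_int] show ?thesis using p_gt_1 by (simp add: field_simps)
qed

subsection \<open>The weight distribution\<close>

definition encode :: "'a \<times> 'a \<Rightarrow> ('a \<times> 'a \<Rightarrow> 'a)" where
  "encode = (\<lambda>(a, b). cw p m u a b)"

definition weight :: "'a \<times> 'a \<Rightarrow> nat" where
  "weight z = hwt p m u (encode z)"

definition generic_weight :: real where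
  "generic_weight = real (p - 1) * real p ^ (2 * m - 2)"

definition high_weight :: real where
  "high_weight = generic_weight * (1 + 1 / real p ^ (s - v))"

definition low_weight :: real where
  "low_weight = generic_weight * (1 - 1 / (real (p - 1) * real p ^ (s - v)))"

definition pairs_over :: "'a set \<Rightarrow> ('a \<times> 'a) set" where
  "pairs_over S = {(a, b). a \<in> prime_subfield - {0} \<and> b / a \<in> S}"

definition high_pairs :: "('a \<times> 'a) set" where
  "high_pairs = pairs_over (gold_polar ` {c. gold c = 0})"

definition low_pairs :: "('a \<times> 'a) set" where
  "low_pairs = pairs_over (gold_polar ` {c. gold c \<noteq> 0})"

definition generic_pairs :: "('a \<times> 'a) set" where
  "generic_pairs = - insert 0 (high_pairs \<union> low_pairs)"

lemma real_p_minus_1: "real (p - 1) = real p - 1"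
  using p_gt_1 by simp

lemma trace_graph_gold: "trace_graph gold = insert (0, 0) (D1 p m u)"
proof -
  have "tr p m (x + y ^ (p ^ u + 1)) = Tr x + gold y" for x y :: 'a
    by (simp only: tr.add gold_def)
  thus ?thesis
    using Q_radical[OF zero_in_radical] tr.zero unfolding trace_graph_def D1_def by auto
qed

lemma card_D1: "card (D1 p m u :: ('a \<times> 'a) set) = p ^ (2 * m - 1) - 1"
proof -
  have "card (trace_graph gold) = Suc (card (D1 p m u :: ('a \<times> 'a) set))"
    by (simp add: trace_graph_gold) (simp add: D1_def)
  moreover have "p * card (trace_graph gold) = p * p ^ (2 * m - 1)"
    using card_trace_graph[where f = gold, OF Q_in_prime_subfield] m_pos by (simp flip: power_Suc)
  hence "card (trace_graph gold) = p ^ (2 * m - 1)" using p_gt_1 by simp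
  ultimately show ?thesis by simp
qed

lemma weight_add_card_section:
  "weight (a, b) + card (trace_graph_section gold a b) = card (trace_graph gold)"
proof -
  have "{z \<in> D1 p m u. cw p m u a b z \<noteq> 0} = trace_graph gold - trace_graph_section gold a b"
    by (auto simp: trace_graph_section_def trace_graph_gold cw_def tr.zero)
  moreover have "trace_graph_section gold a b \<subseteq> trace_graph gold"
    by (auto simp: trace_graph_section_def)
  ultimately show ?thesis
    by (simp add: weight_def encode_def hwt_def card_Diff_subset card_mono)
qed

lemma real_weight_eq:
  "real (weight (a, b)) = (real p ^ m)\<^sup>2 / real p - real (card (trace_graph_section gold a b))"
proof -
  have "real p * real (card (trace_graph gold)) = (real p ^ m)\<^sup>2"
    using arg_cong[OF card_trace_graph[where f = gold, OF Q_in_prime_subfield], of real]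
    by (simp add: mult.commute flip: power_mult)
  hence "real (card (trace_graph gold)) = (real p ^ m)\<^sup>2 / real p"
    using p_gt_1 by (simp add: field_simps)
  thus ?thesis using arg_cong[OF weight_add_card_section[of a b], of real] by simp
qed

lemma weight_0: "weight 0 = 0"
  by (simp add: weight_def encode_def hwt_def cw_def zero_prod_def tr.zero case_prod_unfold)

lemma real_weight_pairs_over:
  assumes "(a, b) \<in> pairs_over {gold_polar c}"
  shows "real (weight (a, b))
    = (real p ^ m)\<^sup>2 / real p - real p ^ m * real (level_card (gold c)) / real p"
proof -
  have quotient: "a \<in> prime_subfield" "a \<noteq> 0" "b / a = gold_polar c"
    using assms by (auto simp: pairs_over_def)
  have "p * card (trace_graph_section gold a b) = p ^ m * card {y. gold y = Tr (b / a * y)}"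
    using quotient(1,2) by (intro card_trace_graph_section_prime_subfield Q_in_prime_subfield)
  hence "p * card (trace_graph_section gold a b) = p ^ m * level_card (gold c)"
    by (simp only: quotient(3) card_Q_eq_tr_L)
  from arg_cong[OF this, of real]
  have "real (card (trace_graph_section gold a b)) = real p ^ m * real (level_card (gold c)) / real p"
    using p_gt_1 by (simp add: field_simps)
  thus ?thesis by (simp add: real_weight_eq)
qed

lemma real_power_diff: "k \<le> n \<Longrightarrow> real p ^ (n - k) = real p ^ n / real p ^ k"
  using p_gt_1 by (intro power_diff) auto

lemma real_power_m_minus_2v: "real p ^ (m - 2 * v) = (real p ^ (s - v))\<^sup>2"
proof -
  have "m - 2 * v = (s - v) * 2" by (simp add: m_eq)
  thus ?thesis by (simp only: power_mult)
qed

lemma real_power_m: "real p ^ m = (real p ^ (s - v))\<^sup>2 * real p ^ (2 * v)"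
proof -
  have "m = m - 2 * v + 2 * v" using v_less_s m_eq by simp
  thus ?thesis by (metis power_add real_power_m_minus_2v)
qed

lemma real_power_s_plus_v: "real p ^ (s + v) = real p ^ (s - v) * real p ^ (2 * v)"
proof -
  have "s + v = s - v + 2 * v" using v_less_s by simp
  thus ?thesis by (simp only: power_add)
qed

lemma real_power_2m_minus_2: "real p ^ (2 * m - 2) = (real p ^ m)\<^sup>2 / (real p)\<^sup>2"
  using m_pos by (simp add: real_power_diff power_even_eq)

lemma real_power_m_minus_2v_minus_1: "real p ^ (m - 2 * v - 1) = (real p ^ (s - v))\<^sup>2 / real p"
proof -
  have "1 \<le> m - 2 * v" using v_less_s m_eq by linarith
  from real_power_diff[OF this] show ?thesis by (simp only: real_power_m_minus_2v power_one_right)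
qed

lemma real_power_s_minus_v_minus_1: "real p ^ (s - v - 1) = real p ^ (s - v) / real p"
  using real_power_diff[of 1 "s - v"] v_less_s by simp

lemma real_weight_high:
  assumes "(a, b) \<in> high_pairs"
  shows "real (weight (a, b)) = high_weight"
proof -
  obtain c where "(a, b) \<in> pairs_over {gold_polar c}" "gold c = 0"
    using assms by (auto simp: high_pairs_def pairs_over_def)
  hence "real (weight (a, b)) = (real p ^ m)\<^sup>2 / real p
      - real p ^ m * ((real p ^ m - (real p - 1) * real p ^ (s + v)) / real p) / real p"
    by (simp only: real_weight_pairs_over real_level_card_0)
  also have "\<dots> = high_weight"
    unfolding high_weight_def generic_weight_def real_p_minus_1 real_power_2m_minus_2 real_power_m
      real_power_s_plus_v
    using p_gt_1 by (simp add: field_simps power2_eq_square)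
  finally show ?thesis .
qed

lemma real_weight_low:
  assumes "(a, b) \<in> low_pairs"
  shows "real (weight (a, b)) = low_weight"
proof -
  obtain c where "(a, b) \<in> pairs_over {gold_polar c}" "gold c \<noteq> 0"
    using assms by (auto simp: low_pairs_def pairs_over_def)
  moreover from this have "level_card (gold c) = level_card 1"
    using level_card_gold_nonzero Q_in_prime_subfield by blast
  ultimately have "real (weight (a, b)) = (real p ^ m)\<^sup>2 / real p
      - real p ^ m * ((real p ^ m + real p ^ (s + v)) / real p) / real p"
    by (simp only: real_weight_pairs_over real_level_card_1)
  also have "\<dots> = low_weight"
    unfolding low_weight_def generic_weight_def real_p_minus_1 real_power_2m_minus_2 real_power_m
      real_power_s_plus_v
    using p_gt_1 by (simp add: field_simps power2_eq_square)
  finally show ?thesis .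
qed

lemma real_weight_generic:
  assumes "(a, b) \<in> generic_pairs"
  shows "real (weight (a, b)) = generic_weight"
proof -
  have not_special: "(a, b) \<noteq> (0, 0)" "(a, b) \<notin> high_pairs" "(a, b) \<notin> low_pairs"
    using assms by (auto simp: generic_pairs_def zero_prod_def)
  have "p * (p * card (trace_graph_section gold a b)) = (p ^ m)\<^sup>2"
  proof (cases "a \<in> prime_subfield - {0}")
    case True
    hence "b / a \<notin> range gold_polar"
      using not_special by (auto simp: high_pairs_def low_pairs_def pairs_over_def)
    hence "p * card {y. gold y = Tr (b / a * y)} = p ^ m" by (rule card_Q_eq_tr_not_range_L)
    moreover have "p * (p * card (trace_graph_section gold a b))
        = p ^ m * (p * card {y. gold y = Tr (b / a * y)})"
      using True card_trace_graph_section_prime_subfield[where f = gold, OF Q_in_prime_subfield, of a b]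
      by simp
    ultimately show ?thesis by (simp add: power2_eq_square)
  next
    case False
    hence "p * card (trace_graph_section gold a b) = card (trace_graph gold)"
      using not_special
        card_trace_graph_section_not_prime_subfield[where f = gold, OF Q_in_prime_subfield]
        card_trace_graph_section_0[where f = gold, OF Q_in_prime_subfield] by auto
    thus ?thesis by (simp add: card_trace_graph[where f = gold, OF Q_in_prime_subfield] power_even_eq)
  qed
  from arg_cong[OF this, of real]
  have "real (card (trace_graph_section gold a b)) = (real p ^ m)\<^sup>2 / (real p)\<^sup>2"
    using p_gt_1 by (simp add: field_simps power2_eq_square)
  thus ?thesis
    unfolding real_weight_eq generic_weight_def real_p_minus_1 real_power_2m_minus_2
    using p_gt_1 by (simp add: field_simps power2_eq_square)
qed

lemma weights_ordered: "0 < low_weight" "low_weight < generic_weight" "generic_weight < high_weight"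
proof -
  have "p \<noteq> 2" using p_odd by auto
  hence "p - 1 \<ge> 2" using p_gt_1 by simp
  moreover have "real p ^ (s - v) \<ge> 1" using p_gt_1 by (intro one_le_power) simp
  ultimately have "real (p - 1) * real p ^ (s - v) \<ge> 2 * 1" by (intro mult_mono) auto
  moreover have "generic_weight > 0" using p_gt_1 by (simp add: generic_weight_def)
  ultimately show "0 < low_weight" "low_weight < generic_weight" "generic_weight < high_weight"
    using p_gt_1 by (simp_all add: low_weight_def high_weight_def)
qed

lemma gold_polar_images_disjoint: "gold_polar ` {c. gold c = 0} \<inter> gold_polar ` {c. gold c \<noteq> 0} = {}"
proof (rule equals0I)
  fix b assume "b \<in> gold_polar ` {c. gold c = 0} \<inter> gold_polar ` {c. gold c \<noteq> 0}"
  then obtain c d where "b = gold_polar c" "gold c = 0" "b = gold_polar d" "gold d \<noteq> 0" by blast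
  thus False using Q_eq_if_L_eq[of c d] by simp
qed

lemma pairs_disjoint: "0 \<notin> high_pairs" "0 \<notin> low_pairs" "high_pairs \<inter> low_pairs = {}"
  using gold_polar_images_disjoint
  by (auto simp: high_pairs_def low_pairs_def pairs_over_def zero_prod_def)

lemma real_weight_cases:
  "real (weight z) = (if z = 0 then 0 else if z \<in> high_pairs then high_weight
    else if z \<in> low_pairs then low_weight else generic_weight)"
  using real_weight_high real_weight_low real_weight_generic weight_0
  by (cases z) (auto simp: generic_pairs_def)

lemma weight_level_sets:
  "{z. weight z = 0} = {0}"
  "{z. real (weight z) = generic_weight} = generic_pairs"
  "{z. real (weight z) = high_weight} = high_pairs"
  "{z. real (weight z) = low_weight} = low_pairs"
proof -
  have "(weight z = 0 \<longleftrightarrow> z = 0) \<and> (real (weight z) = generic_weight \<longleftrightarrow> z \<in> generic_pairs) \<and>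
    (real (weight z) = high_weight \<longleftrightarrow> z \<in> high_pairs) \<and>
    (real (weight z) = low_weight \<longleftrightarrow> z \<in> low_pairs)" for z
  proof -
    consider "z = 0" | "z \<in> high_pairs" | "z \<in> low_pairs" | "z \<in> generic_pairs"
      by (auto simp: generic_pairs_def)
    thus ?thesis
      using real_weight_cases[of z] weights_ordered pairs_disjoint
      by cases (auto simp: generic_pairs_def)
  qed
  thus "{z. weight z = 0} = {0}"
    "{z. real (weight z) = generic_weight} = generic_pairs"
    "{z. real (weight z) = high_weight} = high_pairs"
    "{z. real (weight z) = low_weight} = low_pairs" by auto
qed

lemma card_pairs_over: "card (pairs_over S) = (p - 1) * card S"
proof -
  have "bij_betw (\<lambda>(a, c). (a, a * c)) ((prime_subfield - {0}) \<times> S) (pairs_over S)"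
    by (rule bij_betw_byWitness[where f' = "\<lambda>(a, b). (a, b / a)"]) (auto simp: pairs_over_def)
  from bij_betw_same_card[OF this] show ?thesis
    using prime_subfield_0 by (simp add: card_cartesian_product card_Diff_singleton card_prime_subfield)
qed

lemma real_card_range_gold_polar: "real (card (range gold_polar)) = (real p ^ (s - v))\<^sup>2"
proof -
  have "p ^ m = p ^ (2 * v) * card (range gold_polar)"
    using card_eq_card_radical_mult_card_L_image[of UNIV] by (simp add: card_UNIV card_radical)
  from arg_cong[OF this, of real] show ?thesis using p_gt_1 by (simp add: real_power_m)
qed

lemma real_card_gold_polar_image_zeros:
  "real (card (gold_polar ` {c. gold c = 0}))
    = ((real p ^ (s - v))\<^sup>2 - (real p - 1) * real p ^ (s - v)) / real p"
proof -
  have "level_card 0 = p ^ (2 * v) * card (gold_polar ` {c. gold c = 0})"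
    using card_eq_card_radical_mult_card_L_image[of "{c. gold c = 0}"]
    by (simp add: level_card_def card_radical Q_add_radical)
  hence "real p ^ (2 * v) * real (card (gold_polar ` {c. gold c = 0}))
      = (real p ^ m - (real p - 1) * real p ^ (s + v)) / real p"
    by (simp flip: real_level_card_0)
  also have "\<dots> = real p ^ (2 * v) * (((real p ^ (s - v))\<^sup>2 - (real p - 1) * real p ^ (s - v)) / real p)"
    unfolding real_power_m real_power_s_plus_v by (simp add: algebra_simps)
  finally show ?thesis using p_gt_1 by (simp del: times_divide_eq_right)
qed

lemma real_card_high_pairs:
  "real (card high_pairs)
    = real (p - 1) * (real p ^ (m - 2 * v - 1) - real p ^ (s - v) + real p ^ (s - v - 1))"
  unfolding high_pairs_def card_pairs_over of_nat_mult real_card_gold_polar_image_zeros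
    real_power_m_minus_2v_minus_1 real_power_s_minus_v_minus_1
  using p_gt_1 by (simp add: field_simps)

lemma real_card_high_add_low_pairs:
  "real (card high_pairs) + real (card low_pairs) = real (p - 1) * real p ^ (m - 2 * v)"
proof -
  have "range gold_polar = gold_polar ` {c. gold c = 0} \<union> gold_polar ` {c. gold c \<noteq> 0}" by auto
  hence "card (range gold_polar)
      = card (gold_polar ` {c. gold c = 0}) + card (gold_polar ` {c. gold c \<noteq> 0})"
    by (simp add: card_Un_disjoint gold_polar_images_disjoint)
  thus ?thesis
    by (simp add: high_pairs_def low_pairs_def card_pairs_over real_power_m_minus_2v
        flip: real_card_range_gold_polar distrib_left)
qed

lemma real_card_low_pairs:
  "real (card low_pairs)
    = real (p - 1) * (real p ^ (s - v) + 1) * (real p ^ (s - v) - real p ^ (s - v - 1))"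
proof -
  have "real (card low_pairs) = real (p - 1) * real p ^ (m - 2 * v) - real (card high_pairs)"
    using real_card_high_add_low_pairs by simp
  thus ?thesis
    unfolding real_card_high_pairs real_power_m_minus_2v real_power_m_minus_2v_minus_1
      real_power_s_minus_v_minus_1 by (simp add: algebra_simps power2_eq_square)
qed

lemma card_UNIV_pairs: "card (UNIV :: ('a \<times> 'a) set) = p ^ (2 * m)"
  by (simp add: card_UNIV mult_2 power_add card_cartesian_product flip: UNIV_Times_UNIV)

lemma real_card_generic_pairs:
  "real (card generic_pairs) = real p ^ (2 * m) - 1 - real (p - 1) * real p ^ (m - 2 * v)"
proof -
  have "card (insert 0 (high_pairs \<union> low_pairs)) = 1 + card high_pairs + card low_pairs"
    using pairs_disjoint by (simp add: card_Un_disjoint)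
  moreover have "card generic_pairs + card (insert 0 (high_pairs \<union> low_pairs)) = p ^ (2 * m)"
    unfolding card_UNIV_pairs[symmetric]
    by (subst card_Un_disjoint[symmetric])
      (auto simp: generic_pairs_def intro: arg_cong[of _ _ card] simp del: card_prod)
  ultimately have
    "real (card generic_pairs + (1 + card high_pairs + card low_pairs)) = real (p ^ (2 * m))"
    by (simp only:)
  thus ?thesis using real_card_high_add_low_pairs by simp
qed

lemma encode_diff: "encode (z - z') x = encode z x - encode z' x"
  by (simp add: encode_def cw_def case_prod_unfold left_diff_distrib add_diff_add flip: tr.diff)

lemma inj_encode: "inj encode"
proof (rule injI)
  fix z z' assume "encode z = encode z'"
  hence "weight (z - z') = 0" by (simp add: weight_def hwt_def encode_diff)
  hence "z - z' \<in> {z. weight z = 0}" by simp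
  thus "z = z'" by (simp add: weight_level_sets(1))
qed

lemma code_eq_range_encode: "code p m u = range encode"
  by (auto simp: code_def encode_def)

lemma card_code: "card (code p m u :: ('a \<times> 'a \<Rightarrow> 'a) set) = p ^ (2 * m)"
  by (simp add: code_eq_range_encode card_image inj_encode card_UNIV_pairs del: card_prod)

lemma wmult_eq: "wmult p m u TYPE('a) n = card {z. weight z = n}"
proof -
  have "{c \<in> range encode. hwt p m u c = n} = encode ` {z. weight z = n}"
    by (auto simp: weight_def)
  moreover have "inj_on encode {z. weight z = n}"
    using inj_encode by (rule inj_on_subset) simp
  ultimately show ?thesis by (simp only: wmult_def code_eq_range_encode card_image)
qed

lemma wmult_0: "wmult p m u TYPE('a) 0 = 1"
  by (simp add: wmult_eq weight_level_sets)

lemma wmult_nonzero: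
  "real n = generic_weight \<Longrightarrow> wmult p m u TYPE('a) n = card generic_pairs"
  "real n = high_weight \<Longrightarrow> wmult p m u TYPE('a) n = card high_pairs"
  "real n = low_weight \<Longrightarrow> wmult p m u TYPE('a) n = card low_pairs"
  by (simp_all add: wmult_eq flip: weight_level_sets of_nat_eq_iff[where 'a = real])

lemma weights_attained:
  "\<exists>z. real (weight z) = generic_weight"
  "\<exists>z. real (weight z) = high_weight"
  "\<exists>z. real (weight z) = low_weight"
proof -
  have "(0, 1) \<in> generic_pairs"
    by (auto simp: generic_pairs_def high_pairs_def low_pairs_def pairs_over_def zero_prod_def)
  thus "\<exists>z. real (weight z) = generic_weight" using real_weight_generic by blast
  have "(1, gold_polar 0) \<in> high_pairs"
    using prime_subfield_1 Q_radical[OF zero_in_radical] by (auto simp: high_pairs_def pairs_over_def)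
  thus "\<exists>z. real (weight z) = high_weight" using real_weight_high by blast
  have "real (level_card 1) > 0" using p_gt_1 by (simp add: real_level_card_1 add_pos_pos)
  then obtain c where "gold c = 1" by (auto simp: level_card_def card_gt_0_iff)
  hence "(1, gold_polar c) \<in> low_pairs"
    using prime_subfield_1 by (auto simp: low_pairs_def pairs_over_def)
  thus "\<exists>z. real (weight z) = low_weight" using real_weight_low by blast
qed

lemma nonzero_weights:
  "{n. n \<noteq> 0 \<and> (\<exists>c \<in> (code p m u :: ('a \<times> 'a \<Rightarrow> 'a) set). hwt p m u c = n)}
    = {n. real n = generic_weight \<or> real n = high_weight \<or> real n = low_weight}" (is "?weights = _")
proof -
  have "?weights = {n. n \<noteq> 0 \<and> (\<exists>z. weight z = n)}"
    by (simp add: code_eq_range_encode weight_def)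
  also have "\<dots> = {n. real n = generic_weight \<or> real n = high_weight \<or> real n = low_weight}"
  proof (intro equalityI subsetI)
    fix n assume "n \<in> {n. n \<noteq> 0 \<and> (\<exists>z. weight z = n)}"
    then obtain z where "n = weight z" "weight z \<noteq> 0" by auto
    thus "n \<in> {n. real n = generic_weight \<or> real n = high_weight \<or> real n = low_weight}"
      using real_weight_cases[of z] by (auto split: if_splits)
  next
    fix n :: nat assume "n \<in> {n. real n = generic_weight \<or> real n = high_weight \<or> real n = low_weight}"
    hence n_weight: "real n = generic_weight \<or> real n = high_weight \<or> real n = low_weight" by simp
    then obtain z where "real (weight z) = real n"
      using weights_attained by metis
    hence "weight z = n" "n \<noteq> 0" using n_weight weights_ordered by auto
    thus "n \<in> {n. n \<noteq> 0 \<and> (\<exists>z. weight z = n)}" by blast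
  qed
  finally show ?thesis .
qed

lemma card_nonzero_weights:
  "card {n. real n = generic_weight \<or> real n = high_weight \<or> real n = low_weight} = 3"
proof -
  obtain y1 y2 y3 where attained: "real (weight y1) = generic_weight" "real (weight y2) = high_weight"
    "real (weight y3) = low_weight"
    using weights_attained by blast
  have "{n. real n = generic_weight \<or> real n = high_weight \<or> real n = low_weight}
      = {weight y1, weight y2, weight y3}"
    unfolding attained[symmetric] of_nat_eq_iff by auto
  moreover have "weight y1 \<noteq> weight y2" "weight y1 \<noteq> weight y3" "weight y2 \<noteq> weight y3"
    using attained weights_ordered by auto
  ultimately show ?thesis by simp
qed

end

theorem theorem4:
  fixes p m u :: nat
  assumes "prime p" and "odd p"
    and "m > 0" and "even m"
    and "u > 0"
    and "card (UNIV :: ('a::{field,finite}) set) = p ^ m" and "CHAR('a) = p"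
    and "(m div gcd m u) mod 4 = 0"
  defines "v \<equiv> gcd m u"
    and "s \<equiv> m div 2"
  shows
    "card (D1 p m u :: ('a \<times> 'a) set) = p ^ (2*m - 1) - 1
     \<and> card (code p m u :: ('a \<times> 'a \<Rightarrow> 'a) set) = p ^ (2*m)
     \<and> card {w. w \<noteq> 0 \<and> (\<exists>c \<in> (code p m u :: ('a \<times> 'a \<Rightarrow> 'a) set). hwt p m u c = w)} = 3
     \<and> {w. w \<noteq> 0 \<and> (\<exists>c \<in> (code p m u :: ('a \<times> 'a \<Rightarrow> 'a) set). hwt p m u c = w)}
         = {w. real w = real (p-1) * real p ^ (2*m-2)
             \<or> real w = real (p-1) * real p ^ (2*m-2) * (1 + 1 / real p ^ (s-v))
             \<or> real w = real (p-1) * real p ^ (2*m-2) * (1 - 1 / (real (p-1) * real p ^ (s-v)))}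
     \<and> wmult p m u TYPE('a) 0 = 1
     \<and> (\<forall>w. real w = real (p-1) * real p ^ (2*m-2) \<longrightarrow>
           real (wmult p m u TYPE('a) w) = real p ^ (2*m) - 1 - real (p-1) * real p ^ (m - 2*v))
     \<and> (\<forall>w. real w = real (p-1) * real p ^ (2*m-2) * (1 + 1 / real p ^ (s-v)) \<longrightarrow>
           real (wmult p m u TYPE('a) w) =
             real (p-1) * (real p ^ (m - 2*v - 1) - real p ^ (s-v) + real p ^ (s-v-1)))
     \<and> (\<forall>w. real w = real (p-1) * real p ^ (2*m-2) * (1 - 1 / (real (p-1) * real p ^ (s-v))) \<longrightarrow>
           real (wmult p m u TYPE('a) w) =
             real (p-1) * (real p ^ (s-v) + 1) * (real p ^ (s-v) - real p ^ (s-v-1)))"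
proof -
  interpret gold_code p m "TYPE('a)" u v s
  proof
    show "v = gcd m u" and "s = m div 2" by (simp_all only: v_def s_def)
    show "4 dvd m div v" using assms(8) unfolding v_def by (rule mod_0_imp_dvd)
  qed (fact assms)+
  show ?thesis
    unfolding generic_weight_def[symmetric]
    unfolding high_weight_def[symmetric] low_weight_def[symmetric]
    by (intro conjI allI impI)
      (simp_all only: card_D1 card_code nonzero_weights card_nonzero_weights wmult_0 wmult_nonzero
        real_card_generic_pairs real_card_high_pairs real_card_low_pairs)
qed

end
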